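(* Let $A$ be a finite set with at least two elements, let $C$ be a clone on $A$, and assume that there is a clone $D$ on $A$ such that for all $n\in\mathbb{N}$ and $T\subseteq A^n$ the following equivalence holds: $T$ is the solution set of a system of $C$-equations if and only if $T$ is closed under $D$. Then $D=C^{\ast}$.
   Context: Here $\mathbb{N}$ is the set of positive integers. An operation on $A$ is a map $f\colon A^n\to A$ with $n\ge 1$; $\mathcal{O}_A$ is the set of all operations on $A$, and $F^{(n)}$ is the set of $n$-ary members of $F\subseteq\mathcal{O}_A$. A clone on $A$ is a set $C\subseteq\mathcal{O}_A$ that contains all projections and is closed under composition. Operations $f\in\mathcal{O}_A^{(n)}$ and $g\in\mathcal{O}_A^{(m)}$ commute if $f(g(a_{11},\dots,a_{1m}),\dots,g(a_{n1},\dots,a_{nm}))=g(f(a_{11},\dots,a_{n1}),\dots,f(a_{1m},\dots,a_{nm}))$ for all $a_{ij}\in A$. The centralizer of $F\subseteq\mathcal{O}_A$ is $F^{\ast}=\{g\in\mathcal{O}_A : g \text{ commutes with every } f\in F\}$. A set $T\subseteq A^n$ is closed under a clone $D$ if for all $m\ge1$, $\mathbf{t}^{(1)},\dots,\mathbf{t}^{(m)}\in T$ and $f\in D^{(m)}$, the tuple obtained by applying $f$ componentwise to $\mathbf{t}^{(1)},\dots,\mathbf{t}^{(m)}$ is in $T$. A system of $C$-equations is a finite set $\mathcal{E}=\{(f_1,g_1),\dots,(f_t,g_t)\}$ with $f_i,g_i\in C^{(n)}$ (all of the same arity $n$); its solution set is $\operatorname{Sol}(\mathcal{E})=\{\mathbf{a}\in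 A^n : f_i(\mathbf{a})=g_i(\mathbf{a}) \text{ for } i=1,\dots,t\}$. *)

theory Defs
  imports Main "HOL-Library.FuncSet"
begin

text \<open>
  An element of $A^n$ is a list of length \<open>n\<close> over \<open>A\<close>, with coordinates numbered from 0. An
  operation is a pair of its arity and a function that is \<open>undefined\<close> outside $A^n$; thus equality
  of such pairs is equality of operations.
\<close>

definition tuples :: "'a set \<Rightarrow> nat \<Rightarrow> 'a list set" where
  "tuples A n = {xs. length xs = n \<and> set xs \<subseteq> A}"

type_synonym 'a operation = "nat \<times> ('a list \<Rightarrow> 'a)"

definition operations :: "'a set \<Rightarrow> 'a operation set" where
  "operations A = {(n, f). n \<ge> 1 \<and> f \<in> tuples A n \<rightarrow>\<^sub>E A}"

definition nary :: "'a operation set \<Rightarrow> nat \<Rightarrow> ('a list \<Rightarrow> 'a) set" where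
  "nary F n = {f. (n, f) \<in> F}"

definition projection :: "'a set \<Rightarrow> nat \<Rightarrow> nat \<Rightarrow> 'a list \<Rightarrow> 'a" where
  "projection A n i = (\<lambda>xs\<in>tuples A n. xs ! i)"

definition composition ::
    "'a set \<Rightarrow> nat \<Rightarrow> ('a list \<Rightarrow> 'a) \<Rightarrow> ('a list \<Rightarrow> 'a) list \<Rightarrow> 'a list \<Rightarrow> 'a" where
  "composition A m f gs = (\<lambda>xs\<in>tuples A m. f (map (\<lambda>g. g xs) gs))"

definition clone :: "'a set \<Rightarrow> 'a operation set \<Rightarrow> bool" where
  "clone A C \<longleftrightarrow>
     C \<subseteq> operations A \<and>
     (\<forall>n i. i < n \<longrightarrow> projection A n i \<in> nary C n) \<and>
     (\<forall>n m f gs. f \<in> nary C n \<longrightarrow> length gs = n \<longrightarrow> set gs \<subseteq> nary C m \<longrightarrow>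
        composition A m f gs \<in> nary C m)"

definition commute :: "'a set \<Rightarrow> 'a operation \<Rightarrow> 'a operation \<Rightarrow> bool" where
  "commute A = (\<lambda>(n, f) (m, g).
     \<forall>a :: nat \<Rightarrow> nat \<Rightarrow> 'a. (\<forall>i<n. \<forall>j<m. a i j \<in> A) \<longrightarrow>
       f (map (\<lambda>i. g (map (\<lambda>j. a i j) [0..<m])) [0..<n]) =
       g (map (\<lambda>j. f (map (\<lambda>i. a i j) [0..<n])) [0..<m]))"

definition centralizer :: "'a set \<Rightarrow> 'a operation set \<Rightarrow> 'a operation set" where
  "centralizer A F = {g \<in> operations A. \<forall>f\<in>F. commute A g f}"

definition closed_under :: "nat \<Rightarrow> 'a list set \<Rightarrow> 'a operation set \<Rightarrow> bool" where
  "closed_under n T D \<longleftrightarrow>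
     (\<forall>m\<ge>1. \<forall>ts f. length ts = m \<longrightarrow> set ts \<subseteq> T \<longrightarrow> f \<in> nary D m \<longrightarrow>
        map (\<lambda>i. f (map (\<lambda>t. t ! i) ts)) [0..<n] \<in> T)"

definition equation_system ::
    "'a operation set \<Rightarrow> nat \<Rightarrow> (('a list \<Rightarrow> 'a) \<times> ('a list \<Rightarrow> 'a)) set \<Rightarrow> bool" where
  "equation_system C n E \<longleftrightarrow> finite E \<and> E \<subseteq> nary C n \<times> nary C n"

definition Sol :: "'a set \<Rightarrow> nat \<Rightarrow> (('a list \<Rightarrow> 'a) \<times> ('a list \<Rightarrow> 'a)) set \<Rightarrow> 'a list set" where
  "Sol A n E = {a \<in> tuples A n. \<forall>(f, g)\<in>E. f a = g a}"

end

theory Submission imports Defs begin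

text \<open>
  If \<open>f \<in> C\<close>, then the graph of \<open>f\<close> is the solution set of \<open>f(x\<^sub>1, \<dots>, x\<^sub>n) = x\<^sub>n\<^sub>+\<^sub>1\<close>, hence
  closed under \<open>D\<close>, which says that \<open>D\<close> commutes with \<open>f\<close>. Conversely, solution sets are closed
  under $C^*$, so every set closed under \<open>D\<close> is closed under $C^*$. Listing $A^n$ as
  $a_1, \dots, a_N$, the set $\{(f(a_1), \dots, f(a_N)) : f \in D^{(n)}\}$ of value tables is closed
  under \<open>D\<close> and contains the tables of the projections; applying an \<open>n\<close>-ary \<open>g\<close> from $C^*$ to these
  gives the table of \<open>g\<close>.
\<close>

lemma length_tuples: "xs \<in> tuples A n \<Longrightarrow> length xs = n"
  by (simp add: tuples_def)

lemma nth_tuples: "xs \<in> tuples A n \<Longrightarrow> i < n \<Longrightarrow> xs ! i \<in> A"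
  by (auto simp: tuples_def)

lemma map_upt_in_tuples: "(\<And>i. i < n \<Longrightarrow> h i \<in> A) \<Longrightarrow> map h [0..<n] \<in> tuples A n"
  by (auto simp: tuples_def)

lemma finite_tuples: "finite A \<Longrightarrow> finite (tuples A n)"
  unfolding tuples_def using finite_lists_length_eq[of A n] by (simp add: conj_commute)

lemma clone_naryD:
  assumes "clone A C" "f \<in> nary C n"
  shows "n \<ge> 1" "f \<in> tuples A n \<rightarrow>\<^sub>E A"
  using assms by (auto simp: clone_def nary_def operations_def)

lemma clone_projection: "clone A C \<Longrightarrow> i < n \<Longrightarrow> projection A n i \<in> nary C n"
  by (auto simp: clone_def)

lemma clone_composition:
  "clone A C \<Longrightarrow> f \<in> nary C n \<Longrightarrow> length gs = n \<Longrightarrow> set gs \<subseteq> nary C m \<Longrightarrow>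
    composition A m f gs \<in> nary C m"
  unfolding clone_def by blast

lemma closed_underD:
  assumes "closed_under n T D" "f \<in> nary D m" "m \<ge> 1" "length ts = m" "set ts \<subseteq> T"
  shows "map (\<lambda>i. f (map (\<lambda>t. t ! i) ts)) [0..<n] \<in> T"
  using assms unfolding closed_under_def by blast

text \<open>Read the members of \<open>ts\<close> as the rows of the matrix in
  \<open>commute\<close>: its entry in row \<open>i\<close>, column \<open>j\<close> is
  \<open>ts ! i ! j\<close>, and each row, rebuilt from its entries, is the tuple itself. This gives
  commutation for lists of tuples, the shape in which \<open>closed_under\<close> applies
  operations.\<close>

lemma commute_tuples:
  assumes "commute A (m, g) (n, f)" "length ts = m" "set ts \<subseteq> tuples A n"
  shows "f (map (\<lambda>j. g (map (\<lambda>t. t ! j) ts)) [0..<n]) = g (map f ts)"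
proof -
  have mem: "ts ! i \<in> tuples A n" if "i < m" for i
    using assms that by auto
  then have row: "map (\<lambda>j. ts ! i ! j) [0..<n] = ts ! i" if "i < m" for i
    using that length_tuples map_nth by metis
  from mem have "\<forall>i<m. \<forall>j<n. ts ! i ! j \<in> A"
    by (auto intro: nth_tuples)
  then have "g (map (\<lambda>i. f (map (\<lambda>j. ts ! i ! j) [0..<n])) [0..<m]) =
      f (map (\<lambda>j. g (map (\<lambda>i. ts ! i ! j) [0..<m])) [0..<n])"
    using assms(1)[unfolded commute_def prod.case, THEN spec[where x = "\<lambda>i j. ts ! i ! j"]]
    by (rule rev_mp)
  moreover have "map (\<lambda>i. f (map (\<lambda>j. ts ! i ! j) [0..<n])) [0..<m] = map f ts"
    using row assms(2) by (intro nth_equalityI) auto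
  moreover have "map (\<lambda>i. ts ! i ! j) [0..<m] = map (\<lambda>t. t ! j) ts" for j
    using assms(2) by (intro nth_equalityI) auto
  ultimately show ?thesis by simp
qed

text \<open>Both sides \<open>p\<close> and \<open>q\<close> of an equation can be moved inside
  \<open>g\<close> by commutation. There they act on the solutions in \<open>ts\<close>, where they
  agree, so they also agree on the tuple produced by \<open>g\<close>.\<close>

lemma Sol_closed_under_centralizer:
  assumes "equation_system C n E"
  shows "closed_under n (Sol A n E) (centralizer A C)"
  unfolding closed_under_def
proof (intro allI impI)
  fix m :: nat and ts g
  assume ts: "length ts = m" "set ts \<subseteq> Sol A n E" and "g \<in> nary (centralizer A C) m"
  then have g: "g \<in> tuples A m \<rightarrow>\<^sub>E A" and com: "\<And>f. f \<in> nary C n \<Longrightarrow> commute A (m, g) (n, f)"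
    by (auto simp: nary_def centralizer_def operations_def)
  let ?r = "map (\<lambda>i. g (map (\<lambda>t. t ! i) ts)) [0..<n]"
  have tup: "set ts \<subseteq> tuples A n"
    using ts by (auto simp: Sol_def)
  have "map (\<lambda>t. t ! i) ts \<in> tuples A m" if "i < n" for i
    using tup ts(1) that by (auto simp: tuples_def[of A m] intro: nth_tuples)
  then have "?r \<in> tuples A n"
    using g by (intro map_upt_in_tuples) auto
  moreover have "p ?r = q ?r" if pq: "(p, q) \<in> E" for p q
  proof -
    have "p \<in> nary C n" "q \<in> nary C n"
      using assms pq by (auto simp: equation_system_def)
    moreover have "map p ts = map q ts"
      using ts(2) pq by (auto simp: Sol_def)
    ultimately show ?thesis
      using commute_tuples[OF com ts(1) tup] by metis
  qed
  ultimately show "?r \<in> Sol A n E"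
    by (auto simp: Sol_def)
qed

lemma graph_is_Sol:
  assumes "clone A C" "f \<in> nary C n"
  shows "\<exists>E. equation_system C (Suc n) E \<and>
    (\<lambda>x. x @ [f x]) ` tuples A n = Sol A (Suc n) E"
proof -
  \<comment> \<open>Both sides of the equation must have arity \<open>Suc n\<close>. So
    \<open>p\<close> is \<open>f\<close> with a dummy last variable, and \<open>q\<close> picks that
    variable, which has index \<open>n\<close>.\<close>
  define p where "p = composition A (Suc n) f (map (projection A (Suc n)) [0..<n])"
  define q where "q = projection A (Suc n) n"
  have "p \<in> nary C (Suc n)"
    unfolding p_def
    by (rule clone_composition[OF assms]) (auto intro: clone_projection[OF assms(1)])
  moreover have "q \<in> nary C (Suc n)"
    unfolding q_def by (rule clone_projection[OF assms(1)]) simp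
  moreover have "(\<lambda>x. x @ [f x]) ` tuples A n = Sol A (Suc n) {(p, q)}"
  proof -
    have eval: "p y = f (take n y)" "q y = y ! n" if "y \<in> tuples A (Suc n)" for y
    proof -
      have "map ((\<lambda>g. g y) \<circ> projection A (Suc n)) [0..<n] = take n y"
        using that by (intro nth_equalityI) (auto simp: projection_def dest: length_tuples)
      then show "p y = f (take n y)" "q y = y ! n"
        using that by (auto simp: p_def q_def composition_def projection_def)
    qed
    have f: "f x \<in> A" if "x \<in> tuples A n" for x
      using clone_naryD(2)[OF assms] that by auto
    show ?thesis
    proof (intro set_eqI iffI)
      fix y assume "y \<in> (\<lambda>x. x @ [f x]) ` tuples A n"
      then obtain x where x: "x \<in> tuples A n" "y = x @ [f x]" by auto
      then have "y \<in> tuples A (Suc n)"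
        using f[OF x(1)] by (auto simp: tuples_def)
      then show "y \<in> Sol A (Suc n) {(p, q)}"
        using x eval[of y] by (auto simp: Sol_def nth_append dest: length_tuples)
    next
      fix y assume "y \<in> Sol A (Suc n) {(p, q)}"
      then have y: "y \<in> tuples A (Suc n)" and "p y = q y" by (auto simp: Sol_def)
      then have "f (take n y) = y ! n" using eval by simp
      moreover have "take n y \<in> tuples A n"
        using y by (auto simp: tuples_def dest: in_set_takeD)
      moreover have "y = take n y @ [y ! n]"
        using length_tuples[OF y] by (metis lessI take_Suc_conv_app_nth take_all order_refl)
      ultimately show "y \<in> (\<lambda>x. x @ [f x]) ` tuples A n"
        by (metis (no_types, lifting) image_eqI)
    qed
  qed
  ultimately show ?thesis
    by (intro exI[of _ "{(p, q)}"]) (auto simp: equation_system_def)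
qed

text \<open>Apply \<open>g\<close> to the \<open>m\<close> points of the graph lying over the rows
  of \<open>a\<close>. The first \<open>n\<close> coordinates of the result are the values of
  \<open>g\<close> on the columns, and the last is \<open>g\<close> of the values of
  \<open>f\<close> on the rows; lying on the graph is exactly the commutation identity.\<close>

lemma commute_if_graph_closed:
  assumes "closed_under (Suc n) ((\<lambda>x. x @ [f x]) ` tuples A n) D" "g \<in> nary D m" "m \<ge> 1"
  shows "commute A (m, g) (n, f)"
  unfolding commute_def prod.case
proof (intro allI impI)
  fix a :: "nat \<Rightarrow> nat \<Rightarrow> 'a"
  assume a: "\<forall>i<m. \<forall>j<n. a i j \<in> A"
  define row where "row i = map (a i) [0..<n]" for i
  define ts where "ts = map (\<lambda>i. row i @ [f (row i)]) [0..<m]"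
  let ?col = "\<lambda>j. g (map (\<lambda>i. a i j) [0..<m])"
  have "row i \<in> tuples A n" if "i < m" for i
    unfolding row_def using a that by (intro map_upt_in_tuples) auto
  then have "set ts \<subseteq> (\<lambda>x. x @ [f x]) ` tuples A n"
    by (auto simp: ts_def)
  then have "map (\<lambda>j. g (map (\<lambda>t. t ! j) ts)) [0..<Suc n] \<in> (\<lambda>x. x @ [f x]) ` tuples A n"
    by (intro closed_underD[OF assms]) (auto simp: ts_def)
  moreover have "map (\<lambda>j. g (map (\<lambda>t. t ! j) ts)) [0..<Suc n] =
      map ?col [0..<n] @ [g (map (\<lambda>i. f (row i)) [0..<m])]"
    by (auto simp: ts_def row_def nth_append comp_def)
  ultimately have "map ?col [0..<n] @ [g (map (\<lambda>i. f (row i)) [0..<m])] \<in>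
      (\<lambda>x. x @ [f x]) ` tuples A n"
    by (simp only:)
  \<comment> \<open>The argument \<open>x\<close> of the graph point must be the list of column
    values, so the final entry is \<open>f\<close> of that list.\<close>
  then have "f (map ?col [0..<n]) = g (map (\<lambda>i. f (row i)) [0..<m])"
    by auto
  then show "g (map (\<lambda>i. f (map (\<lambda>j. a i j) [0..<n])) [0..<m]) = f (map ?col [0..<n])"
    by (simp add: row_def)
qed

text \<open>Applying \<open>h\<close> componentwise to the tables of operations \<open>gs\<close>
  yields the table of their composition with \<open>h\<close>, which stays in the clone.\<close>

lemma tables_closed_under:
  assumes "clone A D" "set xs = tuples A n"
  shows "closed_under (length xs) ((\<lambda>f. map f xs) ` nary D n) D"
  unfolding closed_under_def
proof (intro allI impI)
  fix m :: nat and ts h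
  assume ts: "length ts = m" "set ts \<subseteq> (\<lambda>f. map f xs) ` nary D n" and h: "h \<in> nary D m"
  then have "\<forall>t\<in>set ts. \<exists>f. f \<in> nary D n \<and> map f xs = t" by fastforce
  \<comment> \<open>\<open>k\<close> chooses, for each table in \<open>ts\<close>, an operation of
    \<open>D\<close> having that table.\<close>
  then obtain k where k: "\<forall>t\<in>set ts. k t \<in> nary D n \<and> map (k t) xs = t" by metis
  define gs where "gs = map k ts"
  have gs: "set gs \<subseteq> nary D n" "ts = map (\<lambda>f. map f xs) gs"
    unfolding gs_def using k by (auto intro: map_idI[symmetric])
  have "composition A n h gs \<in> nary D n"
    using gs ts(1) by (intro clone_composition[OF assms(1) h]) simp_all
  moreover have "map (\<lambda>i. h (map (\<lambda>t. t ! i) ts)) [0..<length xs] = map (composition A n h gs) xs"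
  proof (rule nth_equalityI)
    fix i assume "i < length (map (\<lambda>i. h (map (\<lambda>t. t ! i) ts)) [0..<length xs])"
    then have i: "i < length xs" by simp
    then have "xs ! i \<in> tuples A n" using assms(2) nth_mem by blast
    then show "map (\<lambda>i. h (map (\<lambda>t. t ! i) ts)) [0..<length xs] ! i =
        map (composition A n h gs) xs ! i"
      using i by (simp add: gs(2) composition_def comp_def)
  qed simp
  ultimately show "map (\<lambda>i. h (map (\<lambda>t. t ! i) ts)) [0..<length xs] \<in> (\<lambda>f. map f xs) ` nary D n"
    by auto
qed

text \<open>The entries at position \<open>i\<close> of the tables of the \<open>n\<close>
  projections form the point \<open>xs ! i\<close>. Hence \<open>g\<close>, applied to these tables,
  produces its own table, which by closure is the table of some \<open>f\<close> in
  \<open>D\<close>.\<close>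

lemma in_nary_if_tables_closed:
  assumes "clone A D" "set xs = tuples A n" "n \<ge> 1" "g \<in> tuples A n \<rightarrow>\<^sub>E A" "g \<in> nary F n"
    and "closed_under (length xs) ((\<lambda>f. map f xs) ` nary D n) F"
  shows "g \<in> nary D n"
proof -
  let ?ts = "map (\<lambda>i. map (projection A n i) xs) [0..<n]"
  have "set ?ts \<subseteq> (\<lambda>f. map f xs) ` nary D n"
    using assms(1) by (auto intro!: imageI[of _ _ "\<lambda>f. map f xs"] clone_projection)
  then have "map (\<lambda>i. g (map (\<lambda>t. t ! i) ?ts)) [0..<length xs] \<in> (\<lambda>f. map f xs) ` nary D n"
    using assms by (intro closed_underD[OF assms(6,5,3)]) auto
  moreover have "map (\<lambda>i. g (map (\<lambda>t. t ! i) ?ts)) [0..<length xs] = map g xs"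
  proof (rule nth_equalityI)
    fix i assume "i < length (map (\<lambda>i. g (map (\<lambda>t. t ! i) ?ts)) [0..<length xs])"
    then have i: "i < length xs" by simp
    then have x: "xs ! i \<in> tuples A n" using assms(2) nth_mem by blast
    then have "map (\<lambda>t. t ! i) ?ts = xs ! i"
      using i by (intro nth_equalityI) (auto simp: projection_def dest: length_tuples)
    then show "map (\<lambda>i. g (map (\<lambda>t. t ! i) ?ts)) [0..<length xs] ! i = map g xs ! i"
      using i by simp
  qed simp
  ultimately obtain f where f: "f \<in> nary D n" "map g xs = map f xs" by auto
  \<comment> \<open>Equal tables give agreement on all of \<open>tuples A n\<close>, since
    \<open>xs\<close> lists every tuple; outside it both functions are
    \<open>undefined\<close>.\<close>
  then have "g = f"
    using assms(2,4) clone_naryD(2)[OF assms(1) f(1)] by (intro PiE_ext) auto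
  with f show ?thesis by simp
qed

theorem corollary3p7:
  fixes A :: "'a set" and C D :: "'a operation set"
  assumes "finite A" and "card A \<ge> 2"
    and "clone A C" and "clone A D"
    and "\<And>n T. n \<ge> 1 \<Longrightarrow> T \<subseteq> tuples A n \<Longrightarrow>
           (\<exists>E. equation_system C n E \<and> T = Sol A n E) \<longleftrightarrow> closed_under n T D"
  shows "D = centralizer A C"
proof (intro set_eqI iffI; clarify)
  fix m g assume "(m, g) \<in> D"
  then have g: "g \<in> nary D m" by (simp add: nary_def)
  have "commute A (m, g) (n, f)" if "(n, f) \<in> C" for n f
  proof (rule commute_if_graph_closed[OF _ g])
    have f: "f \<in> nary C n" using that by (simp add: nary_def)
    have "(\<lambda>x. x @ [f x]) ` tuples A n \<subseteq> tuples A (Suc n)"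
      using graph_is_Sol[OF assms(3) f] by (auto simp: Sol_def)
    then show "closed_under (Suc n) ((\<lambda>x. x @ [f x]) ` tuples A n) D"
      using assms(5)[of "Suc n"] graph_is_Sol[OF assms(3) f] by simp
    show "m \<ge> 1" using clone_naryD(1)[OF assms(4) g] .
  qed
  then show "(m, g) \<in> centralizer A C"
    using \<open>(m, g) \<in> D\<close> assms(4) by (auto simp: centralizer_def clone_def)
next
  fix n g assume gC: "(n, g) \<in> centralizer A C"
  then have n: "n \<ge> 1" and g: "g \<in> tuples A n \<rightarrow>\<^sub>E A"
    by (auto simp: centralizer_def operations_def)
  \<comment> \<open>Finiteness of \<open>A\<close> provides the list of points; repetitions in it do
    no harm.\<close>
  obtain xs where xs: "set xs = tuples A n"
    using finite_tuples[OF assms(1)] finite_list by blast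
  \<comment> \<open>Since \<open>A\<close> is nonempty, \<open>xs\<close> is nonempty, so the
    assumed equivalence applies in dimension \<open>length xs\<close>.\<close>
  obtain a where "a \<in> A" using assms(2) by fastforce
  then have "replicate n a \<in> set xs" unfolding xs by (auto simp: tuples_def)
  then have len: "length xs \<ge> 1" by (cases xs) auto
  let ?T = "(\<lambda>f. map f xs) ` nary D n"
  have "?T \<subseteq> tuples A (length xs)"
    using clone_naryD(2)[OF assms(4)] xs by (fastforce simp: tuples_def)
  then obtain E where "equation_system C (length xs) E" "?T = Sol A (length xs) E"
    using assms(5)[OF len] tables_closed_under[OF assms(4) xs] by metis
  then have "closed_under (length xs) ?T (centralizer A C)"
    using Sol_closed_under_centralizer by metis
  then have "g \<in> nary D n"
    using in_nary_if_tables_closed[OF assms(4) xs n g] gC by (simp add: nary_def)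
  then show "(n, g) \<in> D" by (simp add: nary_def)
qed

end
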